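(* Let $q = p^v$ be a prime power ($p$ prime, $v \in \mathbb{Z}^+$), let $g \in \mathbb{Z}/p^v\mathbb{Z}$, let $d,n \in \mathbb{Z}^+$, and let $\mathcal{F} = (\mathcal{F}_1,\ldots,\mathcal{F}_n)$ be a set system of length $n$ and maximal degree at most $d$. Then: a) $N_{\mathcal{F}}(p^v,g)$ is either $0$ or at least $2^{n-d(p^v-1)}$. b) $\mathcal{N}_{n,d}(p^v) \geq 2^{n-d(p^v-1)}$. c) $f_d(q) = d(p^v-1)+1$.
   Context: A set system is a finite sequence $\mathcal{F} = (\mathcal{F}_1,\ldots,\mathcal{F}_n)$ of finite subsets of some fixed set $X$; $n$ is its length. The maximal degree of $\mathcal{F}$ is $\max_{x \in X} \# \{ 1 \leq i \leq n \mid x \in \mathcal{F}_i\}$. For a positive integer $m$ and $g \in \mathbb{Z}/m\mathbb{Z}$, \[ N_{\mathcal{F}}(m,g) = \# \Big\{ J \subset \{1,\ldots,n\} \ \Big|\ \# \big(\bigcup_{i \in J} \mathcal{F}_i\big) \equiv g \pmod{m} \Big\}, \] where $J = \varnothing$ is allowed (with empty union). For $n,d \in \mathbb{Z}^+$, $\mathcal{N}_{n,d}(m) = \min N_{\mathcal{F}}(m,0)$, the minimum ranging over all set systems $\mathcal{F}$ of length $n$ and maximal degree at most $d$. $f_d(m)$ is the least $n \in \mathbb{Z}^+$ such that for every set system $\mathcal{F}$ of length $n$ and maximal degree at most $d$ there is a nonempty subset $J \subset \{1,\ldots,n\}$ with $m \mid \# (\bigcup_{i \in J} \mathcal{F}_i)$.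 Exponents of $2$ may be negative. *)

theory Defs
  imports Complex_Main "HOL-Library.Infinite_Typeclass" "HOL-Number_Theory.Cong"
begin

(* A set system is the list of its members; the index set {1..n} becomes {..<length F}. *)
definition set_system :: "'a set \<Rightarrow> 'a set list \<Rightarrow> bool" where
  "set_system X F \<longleftrightarrow> (\<forall>S\<in>set F. finite S \<and> S \<subseteq> X)"

(* The supremum is a maximum of natural numbers bounded by the length of F;
   it is 0 if X is empty. *)
definition max_degree :: "'a set \<Rightarrow> 'a set list \<Rightarrow> nat" where
  "max_degree X F = (SUP x\<in>X. card {i. i < length F \<and> x \<in> F ! i})"

(* An element g of Z/mZ is given by any integer representative. *)
definition N_sys :: "'a set list \<Rightarrow> nat \<Rightarrow> int \<Rightarrow> nat" where
  "N_sys F m g =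
     card {J. J \<subseteq> {..<length F} \<and> [int (card (\<Union>i\<in>J. F ! i)) = g] (mod int m)}"

(* "All set systems" ranges over all ground sets X contained in a universe type 'u. Since
   the union of a set system is finite, up to bijection every set system occurs as soon as 'u
   is infinite. Over a universe with too few points min_N and f_least could differ. *)
definition min_N :: "'u::infinite itself \<Rightarrow> nat \<Rightarrow> nat \<Rightarrow> nat \<Rightarrow> nat" where
  "min_N TYPE('u) n d m =
     Inf {N_sys F m 0 | (X :: 'u set) F. set_system X F \<and> length F = n \<and> max_degree X F \<le> d}"

definition f_least :: "'u::infinite itself \<Rightarrow> nat \<Rightarrow> nat \<Rightarrow> nat" where
  "f_least TYPE('u) d m =
     (LEAST n. n > 0 \<and>
        (\<forall>(X :: 'u set) F. set_system X F \<longrightarrow> length F = n \<longrightarrow> max_degree X F \<le> d \<longrightarrow>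
           (\<exists>J \<subseteq> {..<n}. J \<noteq> {} \<and> m dvd card (\<Union>i\<in>J. F ! i))))"

end

theory Submission
  imports Defs
begin

text \<open>
  Let \<open>q = p ^ v\<close>, let \<open>U\<close> be the union of all members of the system, and call an index set \<open>J\<close>
  good if the union over \<open>J\<close> has cardinality congruent to \<open>g\<close> modulo \<open>q\<close>.  If \<open>w\<close> is the number
  of points of \<open>U\<close> that \<open>J\<close> leaves uncovered and \<open>a\<close> is a natural number congruent to
  \<open>g - card U - 1\<close> modulo \<open>q\<close>, then \<open>J\<close> is good iff \<open>q\<close> divides \<open>w + a + 1\<close>, and this holds iff \<open>p\<close> does not
  divide \<open>w + a choose (q - 1)\<close> (lemma \<open>prime_dvd_choose_prime_power_minus_1_iff\<close>).

  This binomial coefficient counts the sets of \<open>q - 1\<close> elements all of which are either uncovered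
  points or one of \<open>a\<close> dummy points.  A point is uncovered by \<open>J\<close> iff \<open>J\<close> avoids the set of at most
  \<open>d\<close> indices of the members that contain it; so the coefficient is, as a function of \<open>J\<close>, a sum of
  indicators of the events that \<open>J\<close> avoids a set of at most \<open>d * (q - 1)\<close> indices.  In terms of the
  indicator vector of \<open>J\<close>, it is a polynomial of degree at most \<open>d * (q - 1)\<close> on the discrete cube.
  Such a function, if it does not vanish identically modulo \<open>p\<close>, is nonzero modulo \<open>p\<close> in at least
  \<open>2 ^ (n - d * (q - 1))\<close> points; this is the minimum distance of Reed--Muller codes (lemma
  \<open>two_power_le_card_support\<close>).  Hence the bound on the number of good sets.

  For \<open>g = 0\<close> the empty set is good, so the number of good sets is not \<open>0\<close>; if
  \<open>n = d * (q - 1) + 1\<close>, there are at least two of them, one of which is nonempty.  That no smaller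
  \<open>n\<close> suffices is seen from \<open>q - 1\<close> disjoint singletons, each repeated at most \<open>d\<close> times.
\<close>

section \<open>Binomial coefficients modulo a prime\<close>

text \<open>Consecutive entries among the first \<open>p ^ v\<close> of row \<open>N\<close> of Pascal's triangle add up to an
  entry \<open>N + 1 choose j\<close> with \<open>0 < j < p ^ v\<close>.  As \<open>p ^ v\<close> divides
  \<open>(N + 1) * (N choose (j - 1)) = j * (N + 1 choose j)\<close>, but not \<open>j\<close>, that entry is divisible by
  \<open>p\<close>.  So these entries of row \<open>N\<close> alternate between \<open>1\<close> and \<open>-1\<close> modulo \<open>p\<close>.\<close>

lemma prime_not_dvd_choose:
  fixes p v N j :: nat
  assumes p: "prime p" and q: "p ^ v dvd N + 1" and "j < p ^ v"
  shows "\<not> p dvd (N choose j)"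
  using \<open>j < p ^ v\<close>
proof (induction j)
  case 0
  then show ?case using p by auto
next
  case (Suc j)
  have "p dvd (Suc N choose Suc j)"
  proof (rule ccontr)
    assume "\<not> p dvd (Suc N choose Suc j)"
    then have "coprime (p ^ v) (Suc N choose Suc j)"
      using p by (simp add: prime_imp_coprime)
    moreover have "p ^ v dvd Suc j * (Suc N choose Suc j)"
      using q unfolding Suc_times_binomial by (intro dvd_mult2) simp
    ultimately have "p ^ v dvd Suc j"
      by (metis coprime_dvd_mult_left_iff)
    then show False using Suc.prems by (auto dest: dvd_imp_le)
  qed
  then have "p dvd (N choose j) + (N choose Suc j)" by simp
  then show ?case using Suc by (metis Suc_lessD dvd_add_left_iff)
qed

lemma prime_dvd_choose_prime_power_minus_1_iff:
  fixes p v N :: nat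
  assumes p: "prime p"
  shows "p dvd (N choose (p ^ v - 1)) \<longleftrightarrow> \<not> p ^ v dvd N + 1"
proof
  have pos: "p ^ v > 0" using p by (simp add: prime_gt_0_nat)
  show "\<not> p ^ v dvd N + 1" if "p dvd (N choose (p ^ v - 1))"
    using prime_not_dvd_choose[OF p, of v N "p ^ v - 1"] that pos by auto
  show "p dvd (N choose (p ^ v - 1))" if *: "\<not> p ^ v dvd N + 1"
  proof (rule ccontr)
    assume "\<not> p dvd (N choose (p ^ v - 1))"
    then have "coprime (p ^ v) (N choose (p ^ v - 1))"
      using p by (simp add: prime_imp_coprime)
    moreover have "p ^ v dvd Suc N * (N choose (p ^ v - 1))"
      using Suc_times_binomial[of "p ^ v - 1" N] pos by (metis Suc_pred' dvd_triv_left)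
    ultimately show False using * by (metis Suc_eq_plus1 coprime_dvd_mult_left_iff)
  qed
qed

section \<open>The support of a polynomial of bounded degree on the discrete cube\<close>

lemma card_subsets_insert:
  assumes "finite I" and "x \<notin> I"
  shows "card {J. J \<subseteq> insert x I \<and> P J} =
         card {J. J \<subseteq> I \<and> P J} + card {J. J \<subseteq> I \<and> P (insert x J)}"
proof -
  have eq: "{J. J \<subseteq> insert x I \<and> P J} =
        {J. J \<subseteq> I \<and> P J} \<union> insert x ` {J. J \<subseteq> I \<and> P (insert x J)}" (is "?L = ?A \<union> ?B")
  proof (rule set_eqI)
    fix J
    show "J \<in> ?L \<longleftrightarrow> J \<in> ?A \<union> ?B"
    proof (cases "x \<in> J")
      case True
      then have "J = insert x (J - {x})" by auto
      then show ?thesis using True assms by (auto intro!: image_eqI[of _ _ "J - {x}"])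
    qed auto
  qed
  have "inj_on (insert x) {J. J \<subseteq> I \<and> P (insert x J)}"
    using assms by (auto simp: inj_on_def)
  moreover have "finite ?A" "finite ?B" using assms by auto
  moreover have "?A \<inter> ?B = {}" using assms by auto
  ultimately show ?thesis unfolding eq by (simp add: card_Un_disjoint card_image)
qed

text \<open>The indicator of \<open>T \<inter> J = {}\<close> is the product of \<open>1 - t i\<close> over \<open>i\<close> in \<open>T\<close>, where \<open>t\<close> is the
  indicator vector of \<open>J\<close>.  The sum below is thus a general multilinear polynomial of degree at most
  \<open>D\<close> on the subsets of \<open>I\<close>, and the lemma bounds from below the number of points in which it does
  not vanish modulo \<open>m\<close>.\<close>

lemma two_power_le_card_support:
  fixes c :: "'k \<Rightarrow> int" and T :: "'k \<Rightarrow> 'i set"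
  assumes "finite I" and "finite K"
    and "\<And>k. k \<in> K \<Longrightarrow> card (T k \<inter> I) \<le> D"
    and "J \<subseteq> I" and "\<not> m dvd (\<Sum>k | k \<in> K \<and> T k \<inter> J = {}. c k)"
  shows "2 ^ card I \<le> 2 ^ D * card {J. J \<subseteq> I \<and> \<not> m dvd (\<Sum>k | k \<in> K \<and> T k \<inter> J = {}. c k)}"
  using assms
proof (induction I arbitrary: K D J rule: finite_induct)
  case empty
  then have "{J. J \<subseteq> {} \<and> \<not> m dvd (\<Sum>k | k \<in> K \<and> T k \<inter> J = {}. c k)} = {{}}" by auto
  then show ?case by simp
next
  case (insert x I)
  define f where "f K J = (\<Sum>k | k \<in> K \<and> T k \<inter> J = {}. c k)" for K J
  define S where "S K = {J. J \<subseteq> I \<and> \<not> m dvd f K J}" for K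
  define K0 where "K0 = {k \<in> K. x \<notin> T k}"
  define K1 where "K1 = {k \<in> K. x \<in> T k}"
  have fin: "finite K" "finite K0" "finite K1"
    using insert.prems(1) by (auto simp: K0_def K1_def)
  have f_insert: "f K (insert x J) = f K0 J" for J
    unfolding f_def K0_def by (rule sum.cong) auto
  have f_split: "f K J = f K0 J + f K1 J" for J
  proof -
    have "{k. k \<in> K \<and> T k \<inter> J = {}} =
        {k. k \<in> K0 \<and> T k \<inter> J = {}} \<union> {k. k \<in> K1 \<and> T k \<inter> J = {}}"
      by (auto simp: K0_def K1_def)
    then show ?thesis unfolding f_def
      using fin by (simp add: K0_def K1_def, subst sum.union_disjoint[symmetric]) auto
  qed
  have count: "card {J. J \<subseteq> insert x I \<and> \<not> m dvd f K J} = card (S K) + card (S K0)"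
    using card_subsets_insert[OF insert.hyps(1,2), of "\<lambda>J. \<not> m dvd f K J"]
    by (simp add: S_def f_insert)
  have IH: "2 ^ card I \<le> 2 ^ E * card (S L)"
    if "finite L" "\<And>k. k \<in> L \<Longrightarrow> card (T k \<inter> I) \<le> E" "S L \<noteq> {}" for L E
    using insert.IH[of L E] that unfolding S_def f_def by blast
  have bound: "card (T k \<inter> I) \<le> D" if "k \<in> K" for k
  proof -
    have "card (T k \<inter> I) \<le> card (T k \<inter> insert x I)"
      using insert.hyps by (intro card_mono) auto
    then show ?thesis using insert.prems(2)[OF that] by simp
  qed
  have bound1: "card (T k \<inter> I) < D" if "k \<in> K1" for k
  proof -
    have "T k \<inter> insert x I = insert x (T k \<inter> I)" "x \<notin> T k \<inter> I"
      using that insert.hyps by (auto simp: K1_def)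
    then show ?thesis
      using insert.prems(2)[of k] insert.hyps that by (simp add: K1_def)
  qed
  have "2 ^ card (insert x I) \<le> 2 ^ D * (card (S K) + card (S K0))"
  proof (cases "S K \<noteq> {} \<and> S K0 \<noteq> {}")
    case True
    have "2 ^ card I \<le> 2 ^ D * card (S K)" using True fin bound by (intro IH) auto
    moreover have "2 ^ card I \<le> 2 ^ D * card (S K0)"
      using True fin bound by (intro IH) (auto simp: K0_def)
    ultimately show ?thesis using insert.hyps by (simp add: algebra_simps)
  next
    case False
    \<comment> \<open>On one of the two facets the function vanishes modulo \<open>m\<close>, so on the other one it agrees up
      to sign with its difference, which has smaller degree.\<close>
    have "{J. J \<subseteq> insert x I \<and> \<not> m dvd f K J} \<noteq> {}"
      using insert.prems(3,4) by (auto simp: f_def)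
    moreover have "finite {J. J \<subseteq> insert x I \<and> \<not> m dvd f K J}"
      using insert.hyps by auto
    ultimately have "card (S K) + card (S K0) \<noteq> 0" unfolding count[symmetric] by simp
    have eq: "card (S K1) = card (S K) + card (S K0)"
    proof (cases "S K = {}")
      case True
      then have "m dvd f K0 J + f K1 J" if "J \<subseteq> I" for J
        using that by (auto simp: S_def f_split)
      then have "m dvd f K0 J \<longleftrightarrow> m dvd f K1 J" if "J \<subseteq> I" for J
        using that by (meson dvd_add_right_iff dvd_add_left_iff)
      then have "S K1 = S K0" by (auto simp: S_def)
      then show ?thesis using True by simp
    next
      case False': False
      then have "S K0 = {}" using False by simp
      then have "S K1 = S K" by (auto simp: S_def f_split dvd_add_right_iff)
      then show ?thesis using \<open>S K0 = {}\<close> by simp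
    qed
    have ne1: "S K1 \<noteq> {}"
    proof
      assume "S K1 = {}"
      then have "card (S K) + card (S K0) = 0" using eq by simp
      then show False using \<open>card (S K) + card (S K0) \<noteq> 0\<close> by contradiction
    qed
    then obtain J' where "\<not> m dvd f K1 J'" by (auto simp: S_def)
    then have "K1 \<noteq> {}" by (auto simp: f_def)
    then obtain E where E: "D = Suc E" using bound1 by (cases D) auto
    have "2 ^ card I \<le> 2 ^ E * card (S K1)"
      using ne1 fin bound1 E by (intro IH) (auto simp: less_Suc_eq_le)
    then show ?thesis using insert.hyps eq E by simp
  qed
  then show ?case unfolding count[symmetric] by (simp add: f_def)
qed

section \<open>Unions of prescribed cardinality modulo a prime power\<close>

lemma degree_le_max_degree:
  assumes "x \<in> X"
  shows "card {i. i < length F \<and> x \<in> F ! i} \<le> max_degree X F"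
  unfolding max_degree_def
proof (rule cSUP_upper[OF assms], rule bdd_aboveI)
  fix k assume "k \<in> (\<lambda>x. card {i. i < length F \<and> x \<in> F ! i}) ` X"
  then obtain y where "k = card {i. i < length F \<and> y \<in> F ! i}" by auto
  also have "\<dots> \<le> card {..<length F}" by (intro card_mono) auto
  finally show "k \<le> length F" by simp
qed

lemma two_power_le_N_sys:
  fixes X :: "'a set"
  assumes p: "prime p" and F: "set_system X F" and d: "max_degree X F \<le> d"
    and N: "N_sys F (p ^ v) g \<noteq> 0"
  shows "2 ^ length F \<le> 2 ^ (d * (p ^ v - 1)) * N_sys F (p ^ v) g"
proof -
  define q n where "q = p ^ v" and "n = length F"
  define U where "U = (\<Union>i<n. F ! i)"
  define a where "a = nat ((g - int (card U) - 1) mod int q)"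
  \<comment> \<open>The elements \<open>Inr b\<close> are the dummy points; no member covers them, so \<open>S (Inr b)\<close> is empty.\<close>
  define Pts :: "('a + nat) set" where "Pts = U <+> {..<a}"
  define K where "K = {B. B \<subseteq> Pts \<and> card B = q - 1}"
  define S :: "'a + nat \<Rightarrow> nat set"
    where "S = case_sum (\<lambda>x. {i. i < n \<and> x \<in> F ! i}) (\<lambda>_. {})"
  define T where "T B = (\<Union>y\<in>B. S y)" for B
  define f where "f J = (\<Sum>B | B \<in> K \<and> T B \<inter> J = {}. 1::int)" for J
  have "q > 0" using p by (simp add: q_def prime_gt_0_nat)
  have finF: "finite (F ! i)" "F ! i \<subseteq> X" if "i < n" for i
    using F that by (auto simp: set_system_def n_def)
  have finU: "finite U" and "U \<subseteq> X" using finF by (auto simp: U_def)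
  have finP: "finite Pts" using finU by (simp add: Pts_def)
  then have finK: "finite K" by (simp add: K_def)
  have a: "[int a = g - int (card U) - 1] (mod int q)"
    using \<open>q > 0\<close> by (simp add: a_def cong_def)
  have card_S: "card (S y) \<le> d" if "y \<in> Pts" for y
  proof (cases y)
    case (Inl x)
    then have "x \<in> X" using that \<open>U \<subseteq> X\<close> by (auto simp: Pts_def)
    then show ?thesis using degree_le_max_degree[of x X F] d Inl by (simp add: S_def n_def)
  qed (simp add: S_def)
  have card_T: "card (T B \<inter> {..<n}) \<le> d * (q - 1)" if "B \<in> K" for B
  proof -
    have B: "finite B" "B \<subseteq> Pts" "card B = q - 1"
      using that finP by (auto simp: K_def intro: finite_subset)
    have T: "T B \<subseteq> {..<n}" by (auto simp: T_def S_def split: sum.splits)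
    have "card (T B) \<le> (\<Sum>y\<in>B. card (S y))" unfolding T_def using B by (intro card_UN_le)
    also have "\<dots> \<le> (\<Sum>y\<in>B. d)" using B card_S by (intro sum_mono) auto
    finally show ?thesis using B T by (simp add: mult.commute Int_absorb2)
  qed
  have good: "[int (card (\<Union>i\<in>J. F ! i)) = g] (mod int q) \<longleftrightarrow> \<not> int p dvd f J"
    if J: "J \<subseteq> {..<n}" for J
  proof -
    define V where "V = (\<Union>i\<in>J. F ! i)"
    have V: "V \<subseteq> U" "finite V" using J finU by (auto simp: V_def U_def intro: finite_subset)
    have "{B. B \<in> K \<and> T B \<inter> J = {}} = {B. B \<subseteq> (U - V) <+> {..<a} \<and> card B = q - 1}"
    proof -
      have "S y \<inter> J = {} \<longleftrightarrow> y \<in> (U - V) <+> {..<a}" if "y \<in> Pts" for y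
        using that J by (cases y) (auto simp: Pts_def S_def V_def)
      moreover have "T B \<inter> J = {} \<longleftrightarrow> (\<forall>y\<in>B. S y \<inter> J = {})" for B
        by (auto simp: T_def)
      moreover have "(U - V) <+> {..<a} \<subseteq> Pts" by (auto simp: Pts_def)
      ultimately have "B \<subseteq> Pts \<and> T B \<inter> J = {} \<longleftrightarrow> B \<subseteq> (U - V) <+> {..<a}" for B
        by (metis subset_iff)
      then show ?thesis unfolding K_def by auto
    qed
    then have "f J = int (card (U - V) + a choose (q - 1))"
      using finU n_subsets[of "(U - V) <+> {..<a}" "q - 1"] by (simp add: f_def card_Plus)
    then have "\<not> int p dvd f J \<longleftrightarrow> q dvd card (U - V) + a + 1"
      using prime_dvd_choose_prime_power_minus_1_iff[OF p] by (simp add: q_def)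
    also have "\<dots> \<longleftrightarrow> int q dvd int (card (U - V) + a + 1)"
      by (simp only: int_dvd_int_iff)
    also have "\<dots> \<longleftrightarrow> int q dvd g - int (card V)"
    proof -
      have "int (card (U - V)) = int (card U) - int (card V)"
        using V finU by (simp add: card_Diff_subset card_mono of_nat_diff)
      then have "int (card (U - V) + a + 1) - (g - int (card V)) =
          int a - (g - int (card U) - 1)" by simp
      then have "int q dvd int (card (U - V) + a + 1) - (g - int (card V))"
        using a by (simp only: cong_iff_dvd_diff)
      then show ?thesis by (metis diff_add_cancel dvd_add_right_iff)
    qed
    also have "\<dots> \<longleftrightarrow> [int (card V) = g] (mod int q)"
      by (simp add: cong_iff_dvd_diff dvd_diff_commute)
    finally show ?thesis by (simp add: V_def)
  qed
  have N_eq: "N_sys F q g = card {J. J \<subseteq> {..<n} \<and> \<not> int p dvd f J}"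
    unfolding N_sys_def n_def[symmetric] using good by (intro arg_cong[where f = card]) auto
  then have "{J. J \<subseteq> {..<n} \<and> \<not> int p dvd f J} \<noteq> {}"
    using N by (metis card.empty q_def)
  then obtain J where "J \<subseteq> {..<n}" "\<not> int p dvd f J" by auto
  then have "2 ^ card {..<n} \<le> 2 ^ (d * (q - 1)) * card {J. J \<subseteq> {..<n} \<and> \<not> int p dvd f J}"
    unfolding f_def using finK card_T by (intro two_power_le_card_support) auto
  then show ?thesis using N_eq by (simp add: q_def n_def)
qed

lemma N_sys_0_pos: "N_sys F m 0 \<noteq> 0"
proof -
  have "{} \<in> {J. J \<subseteq> {..<length F} \<and> [int (card (\<Union>i\<in>J. F ! i)) = 0] (mod int m)}"
    by simp
  moreover have "finite {J. J \<subseteq> {..<length F} \<and> [int (card (\<Union>i\<in>J. F ! i)) = 0] (mod int m)}"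
    by simp
  ultimately show ?thesis unfolding N_sys_def by (metis card_0_eq empty_iff)
qed

lemma exists_nonempty_dvd_card_Union:
  assumes p: "prime p" and F: "set_system X F" and d: "max_degree X F \<le> d"
    and n: "length F > d * (p ^ v - 1)"
  shows "\<exists>J \<subseteq> {..<length F}. J \<noteq> {} \<and> p ^ v dvd card (\<Union>i\<in>J. F ! i)"
proof (rule ccontr)
  assume "\<not> ?thesis"
  then have "{J. J \<subseteq> {..<length F} \<and> [int (card (\<Union>i\<in>J. F ! i)) = 0] (mod int (p ^ v))} \<subseteq> {{}}"
    by (auto simp: cong_0_iff int_dvd_int_iff simp del: of_nat_power)
  then have "N_sys F (p ^ v) 0 \<le> card {{} :: nat set}"
    unfolding N_sys_def by (intro card_mono) auto
  then have "2 ^ (d * (p ^ v - 1)) * N_sys F (p ^ v) 0 \<le> 2 ^ (d * (p ^ v - 1)) * (1::nat)"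
    by (intro mult_left_mono) auto
  also have "\<dots> < 2 ^ length F" using n by simp
  finally show False using two_power_le_N_sys[OF p F d N_sys_0_pos] by (meson not_less)
qed

section \<open>Sharpness\<close>

text \<open>The extremal system: \<open>m - 1\<close> singletons, each repeated \<open>d\<close> times, or an initial segment of
  this list.  A nonempty union has between \<open>1\<close> and \<open>m - 1\<close> elements.\<close>

lemma exists_system_without_dvd_card_Union:
  assumes "d > 0" and "n \<le> d * (m - 1)"
  shows "\<exists>(X :: 'u::infinite set) F. set_system X F \<and> length F = n \<and> max_degree X F \<le> d \<and>
    (\<forall>J \<subseteq> {..<n}. J \<noteq> {} \<longrightarrow> \<not> m dvd card (\<Union>i\<in>J. F ! i))"
proof -
  obtain e :: "nat \<Rightarrow> 'u" where e: "inj e"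
    using infinite_countable_subset[OF infinite_UNIV] by auto
  define F where "F = map (\<lambda>i. {e (i div d)}) [0..<n]"
  have len: "length F = n" by (simp add: F_def)
  have nth: "F ! i = {e (i div d)}" if "i < n" for i using that by (simp add: F_def)
  have "card {i. i < length F \<and> x \<in> F ! i} \<le> d" for x
  proof (cases "x \<in> range e")
    case True
    then obtain j where x: "x = e j" by auto
    have "{i. i < length F \<and> x \<in> F ! i} \<subseteq> {d * j..<d * j + d}"
    proof
      fix i assume "i \<in> {i. i < length F \<and> x \<in> F ! i}"
      then have "i div d = j" using e by (auto simp: len nth x inj_eq)
      moreover have "i = d * (i div d) + i mod d" "i mod d < d" using assms by auto
      ultimately show "i \<in> {d * j..<d * j + d}" by auto
    qed
    then have "card {i. i < length F \<and> x \<in> F ! i} \<le> card {d * j..<d * j + d}"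
      by (intro card_mono) auto
    then show ?thesis by simp
  next
    case False
    then have "{i. i < length F \<and> x \<in> F ! i} = {}" by (auto simp: len nth)
    then show ?thesis by (simp only: card.empty)
  qed
  then have "max_degree UNIV F \<le> d" unfolding max_degree_def by (intro cSUP_least) auto
  moreover have "set_system UNIV F" by (auto simp: set_system_def F_def)
  moreover have "\<not> m dvd card (\<Union>i\<in>J. F ! i)" if J: "J \<subseteq> {..<n}" "J \<noteq> {}" for J
  proof -
    have eq: "(\<Union>i\<in>J. F ! i) = e ` (\<lambda>i. i div d) ` J" using J nth by auto
    have "(\<lambda>i. i div d) ` J \<subseteq> {..<m - 1}"
    proof
      fix y assume "y \<in> (\<lambda>i. i div d) ` J"
      then obtain i where "i < n" "y = i div d" using J by auto
      then show "y \<in> {..<m - 1}" using assms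
        by (simp add: div_less_iff_less_mult mult.commute)
    qed
    then have "card ((\<lambda>i. i div d) ` J) \<le> card {..<m - 1}" by (intro card_mono) auto
    then have "card (\<Union>i\<in>J. F ! i) \<le> m - 1"
      unfolding eq using e by (subst card_image) (auto intro: inj_on_subset)
    moreover have "finite J" using J finite_subset by blast
    then have "card (\<Union>i\<in>J. F ! i) > 0" using J by (simp add: eq card_gt_0_iff)
    ultimately show ?thesis by (auto dest: dvd_imp_le)
  qed
  ultimately show ?thesis using len by blast
qed

theorem theorem4p8:
  fixes p v d n :: nat
    and g :: int
    and X :: "'a set"
    and F :: "'a set list"
  assumes "prime p" and "v > 0" and "d > 0" and "n > 0"
    and "set_system X F" and "length F = n" and "max_degree X F \<le> d"
  shows "(N_sys F (p ^ v) g = 0 \<or>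
            real (N_sys F (p ^ v) g) \<ge> 2 powi (int n - int d * (int (p ^ v) - 1))) \<and>
         real (min_N TYPE('u::infinite) n d (p ^ v)) \<ge> 2 powi (int n - int d * (int (p ^ v) - 1)) \<and>
         f_least TYPE('u) d (p ^ v) = d * (p ^ v - 1) + 1"
proof (intro conjI)
  have powi: "2 powi (int n - int d * (int (p ^ v) - 1)) \<le> real N"
    if "2 ^ n \<le> 2 ^ (d * (p ^ v - 1)) * N" for N
  proof -
    have "int (p ^ v) - 1 = int (p ^ v - 1)"
      using assms(1) by (simp add: of_nat_diff prime_gt_0_nat Suc_leI)
    then have "2 powi (int n - int d * (int (p ^ v) - 1)) =
        (2 :: real) powi (int n - int (d * (p ^ v - 1)))" by simp
    also have "\<dots> = 2 ^ n / 2 ^ (d * (p ^ v - 1))"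
      by (subst power_int_diff) (simp_all del: of_nat_mult)
    also have "\<dots> \<le> real N"
    proof -
      have "real (2 ^ n) \<le> real (2 ^ (d * (p ^ v - 1)) * N)" using that of_nat_mono by blast
      then show ?thesis by (simp add: divide_le_eq mult.commute)
    qed
    finally show ?thesis .
  qed
  show "N_sys F (p ^ v) g = 0 \<or>
      real (N_sys F (p ^ v) g) \<ge> 2 powi (int n - int d * (int (p ^ v) - 1))"
    using two_power_le_N_sys[OF assms(1,5,7)] assms(6) powi by blast

  \<comment> \<open>The set of values that defines the minimum is nonempty, so \<open>Inf\<close> is one of them.\<close>
  let ?A = "{N_sys G (p ^ v) 0 | (Y :: 'u set) G.
      set_system Y G \<and> length G = n \<and> max_degree Y G \<le> d}"
  have "set_system ({} :: 'u set) (replicate n {})" "max_degree ({} :: 'u set) (replicate n {}) \<le> d"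
    by (simp_all add: set_system_def max_degree_def Sup_nat_def)
  then have "N_sys (replicate n ({} :: 'u set)) (p ^ v) 0 \<in> ?A"
    by (intro CollectI exI[of _ "{}"] exI[of _ "replicate n {}"] conjI) simp_all
  then have "Inf ?A \<in> ?A" by (intro Inf_nat_def1) (metis empty_iff)
  then obtain Y :: "'u set" and G where G: "set_system Y G" "length G = n" "max_degree Y G \<le> d"
    and min: "min_N TYPE('u) n d (p ^ v) = N_sys G (p ^ v) 0"
    unfolding min_N_def by blast
  show "real (min_N TYPE('u) n d (p ^ v)) \<ge> 2 powi (int n - int d * (int (p ^ v) - 1))"
    unfolding min using two_power_le_N_sys[OF assms(1) G(1,3) N_sys_0_pos] G(2) powi by blast

  show "f_least TYPE('u) d (p ^ v) = d * (p ^ v - 1) + 1"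
    unfolding f_least_def
  proof (rule Least_equality)
    show "0 < d * (p ^ v - 1) + 1 \<and>
      (\<forall>(X :: 'u set) F. set_system X F \<longrightarrow> length F = d * (p ^ v - 1) + 1 \<longrightarrow> max_degree X F \<le> d \<longrightarrow>
        (\<exists>J \<subseteq> {..<d * (p ^ v - 1) + 1}. J \<noteq> {} \<and> p ^ v dvd card (\<Union>i\<in>J. F ! i)))"
    proof (intro conjI allI impI)
      fix Y :: "'u set" and G
      assume G: "set_system Y G" "length G = d * (p ^ v - 1) + 1" "max_degree Y G \<le> d"
      show "\<exists>J \<subseteq> {..<d * (p ^ v - 1) + 1}. J \<noteq> {} \<and> p ^ v dvd card (\<Union>i\<in>J. G ! i)"
        using exists_nonempty_dvd_card_Union[OF assms(1) G(1,3), of v] unfolding G(2) by simp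
    qed simp
  next
    fix k
    assume k: "0 < k \<and>
      (\<forall>(X :: 'u set) F. set_system X F \<longrightarrow> length F = k \<longrightarrow> max_degree X F \<le> d \<longrightarrow>
        (\<exists>J \<subseteq> {..<k}. J \<noteq> {} \<and> p ^ v dvd card (\<Union>i\<in>J. F ! i)))"
    show "d * (p ^ v - 1) + 1 \<le> k"
    proof (rule ccontr)
      assume "\<not> ?thesis"
      then have "k \<le> d * (p ^ v - 1)" by simp
      then show False
        using exists_system_without_dvd_card_Union[OF assms(3), of k "p ^ v", where ?'u = 'u] k
        by blast
    qed
  qed
qed

end
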